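(* Let $a,b\ge 0$ be real numbers, and for every integer $k\ge 0$ put $\alpha_k=ak$ and $\beta_k=bk$. Let $n\ge 1$ be an integer and define $$\Delta_n(x):=P_n^{(\alpha_n,\beta_n)}(x)\,P_n^{(\alpha_{n+1},\beta_{n+1})}(x)-P_{n-1}^{(\alpha_n,\beta_n)}(x)\,P_{n+1}^{(\alpha_{n+1},\beta_{n+1})}(x),$$ where $P_m^{(\alpha,\beta)}$ denotes the Jacobi polynomial of degree index $m$ with parameters $\alpha,\beta$. Then for all real $x\ge 1$, $$\Delta_n(x)\le 0,$$ and, for $x\ge 1$, equality holds if and only if $x=1$.
   Context: For an integer $m\ge 0$ and real $\alpha,\beta\ge 0$, the Jacobi polynomial is defined for all real $x$ by $$P_m^{(\alpha,\beta)}(x)=\sum_{t=0}^{m}\binom{m+\alpha}{m-t}\binom{m+\beta}{t}\left(\frac{x-1}{2}\right)^t\left(\frac{x+1}{2}\right)^{m-t},$$ where for real $z$ and integer $k\ge 0$, $\binom{z}{k}=\frac{z(z-1)\cdots(z-k+1)}{k!}$ (with $\binom{z}{0}=1$). *)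

theory Defs
  imports Complex_Main
begin

definition jacobi_P :: "nat \<Rightarrow> real \<Rightarrow> real \<Rightarrow> real \<Rightarrow> real" where
  "jacobi_P m \<alpha> \<beta> x =
     (\<Sum>t=0..m. ((real m + \<alpha>) gchoose (m - t)) * ((real m + \<beta>) gchoose t)
        * ((x - 1) / 2) ^ t * ((x + 1) / 2) ^ (m - t))"

definition Delta :: "real \<Rightarrow> real \<Rightarrow> nat \<Rightarrow> real \<Rightarrow> real" where
  "Delta a b n x =
     jacobi_P n (a * real n) (b * real n) x
       * jacobi_P n (a * real (n + 1)) (b * real (n + 1)) x
     - jacobi_P (n - 1) (a * real n) (b * real n) x
       * jacobi_P (n + 1) (a * real (n + 1)) (b * real (n + 1)) x"

end

theory Submission
  imports Defs "HOL-Computational_Algebra.Polynomial"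
    "HOL-Computational_Algebra.Formal_Power_Series"
begin

text \<open>
  Put \<open>Y = (x - 1) / 2\<close>, \<open>c = a + b\<close>, and let \<open>A\<^sub>n\<close>, \<open>B\<^sub>n\<close> be the Jacobi polynomials with parameters
  \<open>(an, bn)\<close> and degrees \<open>n\<close>, \<open>n - 1\<close>, so that \<open>\<Delta>\<^sub>n = A\<^sub>n B\<^sub>n\<^sub>+\<^sub>1 - B\<^sub>n A\<^sub>n\<^sub>+\<^sub>1\<close>. A contiguous relation gives
  \<open>A\<^sub>n / B\<^sub>n = 1 + a + (2 + c) Y + (2 + c) / (1 + c) * Y (1 + Y) y\<^sub>n\<close> with \<open>y\<^sub>n = B\<^sub>n' / (n B\<^sub>n)\<close>,
  the derivative being taken in \<open>Y\<close>; hence the claim is that \<open>y\<^sub>n\<close> increases strictly with \<open>n\<close> for \<open>Y > 0\<close>.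
  Jacobi's differential equation turns into the Riccati equation
  \<open>Y (1 + Y) y\<^sub>n' + (1 + 2 Y) y\<^sub>n + (1 + c) = n G (Y, y\<^sub>n)\<close> with
  \<open>G (Y, y) = 1 + c - Y (1 + Y) y\<^sup>2 - (a + c Y) y\<close>, in which \<open>n\<close> occurs only as a factor on the right.
  A first-zero argument shows \<open>G (Y, y\<^sub>n) > 0\<close>, and then a second one, applied to
  \<open>y\<^sub>n\<^sub>+\<^sub>1 - y\<^sub>n\<close>, gives the monotonicity.
\<close>

section \<open>Expansion at 1\<close>

definition jacobi_coeff :: "nat \<Rightarrow> real \<Rightarrow> real \<Rightarrow> nat \<Rightarrow> real" where
  "jacobi_coeff N \<alpha> \<sigma> k =
     (if k \<le> N then ((real N + \<alpha>) gchoose (N - k)) * ((real N + \<sigma> + real k) gchoose k) else 0)"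

text \<open>Here \<open>\<sigma>\<close> stands for \<open>\<alpha> + \<beta>\<close>, and the variable for \<open>(x - 1) / 2\<close>.\<close>

definition jacobi_poly :: "nat \<Rightarrow> real \<Rightarrow> real \<Rightarrow> real poly" where
  "jacobi_poly N \<alpha> \<sigma> = (\<Sum>k\<le>N. monom (jacobi_coeff N \<alpha> \<sigma> k) k)"

lemma coeff_jacobi_poly [simp]: "coeff (jacobi_poly N \<alpha> \<sigma>) k = jacobi_coeff N \<alpha> \<sigma> k"
  by (simp add: jacobi_poly_def coeff_sum jacobi_coeff_def)

text \<open>Expand the powers of \<open>Y + 1\<close> and exchange the two sums. For fixed
  \<open>k\<close>, trinomial revision extracts a factor free of \<open>t\<close>; Vandermonde's
  convolution sums the rest, adding the upper arguments to \<alpha> + \<beta> + N + k.\<close>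

lemma jacobi_P_eq_poly:
  "jacobi_P N \<alpha> \<beta> (1 + 2 * Y) = poly (jacobi_poly N \<alpha> (\<alpha> + \<beta>)) Y"
proof -
  \<comment> \<open>The contribution of the \<open>t\<close>-th summand of the Jacobi sum to the
    power \<open>Y ^ k\<close>.\<close>
  define g where "g t k = ((real N + \<alpha>) gchoose (N - t)) * ((real N + \<beta>) gchoose t)
      * real ((N - t) choose (k - t)) * Y ^ k" for t k
  have inner: "((real N + \<alpha>) gchoose (N - t)) * ((real N + \<beta>) gchoose t) * Y ^ t * (Y + 1) ^ (N - t)
      = (\<Sum>k=t..N. g t k)" if "t \<le> N" for t
  proof -
    have "(Y + 1) ^ (N - t) = (\<Sum>j\<le>N - t. real ((N - t) choose j) * Y ^ j)"
      by (simp add: binomial_ring)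
    then have "((real N + \<alpha>) gchoose (N - t)) * ((real N + \<beta>) gchoose t) * Y ^ t * (Y + 1) ^ (N - t)
        = (\<Sum>j\<le>N - t. g t (j + t))"
      by (simp add: g_def sum_distrib_left power_add algebra_simps)
    also have "\<dots> = (\<Sum>k=t..N. g t k)"
      by (rule sum.reindex_bij_witness[of _ "\<lambda>k. k - t" "\<lambda>j. j + t"]) (use that in auto)
    finally show ?thesis .
  qed
  have coeff: "(\<Sum>t=0..k. g t k) = jacobi_coeff N \<alpha> (\<alpha> + \<beta>) k * Y ^ k" if "k \<le> N" for k
  proof -
    have "g t k = ((real N + \<alpha>) gchoose (N - k)) * Y ^ k
        * (((real N + \<beta>) gchoose t) * ((\<alpha> + real k) gchoose (k - t)))" if "t \<le> k" for t
    proof -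
      have "((N - t) choose (k - t)) = ((N - t) choose (N - k))"
        using binomial_symmetric[of "k - t" "N - t"] \<open>k \<le> N\<close> \<open>t \<le> k\<close> by simp
      moreover have "((real N + \<alpha>) gchoose (N - t)) * (of_nat (N - t) gchoose (N - k))
          = ((real N + \<alpha>) gchoose (N - k)) * ((real N + \<alpha> - of_nat (N - k)) gchoose (N - t - (N - k)))"
        by (rule gbinomial_trinomial_revision) (use \<open>t \<le> k\<close> in simp)
      moreover have "real N + \<alpha> - of_nat (N - k) = \<alpha> + real k" "N - t - (N - k) = k - t"
        using \<open>k \<le> N\<close> \<open>t \<le> k\<close> by (auto simp: of_nat_diff)
      ultimately show ?thesis
        by (simp add: g_def binomial_gbinomial mult_ac)
    qed
    then have "(\<Sum>t=0..k. g t k) = ((real N + \<alpha>) gchoose (N - k)) * Y ^ k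
        * (\<Sum>t=0..k. ((real N + \<beta>) gchoose t) * ((\<alpha> + real k) gchoose (k - t)))"
      by (simp add: sum_distrib_left)
    then show ?thesis
      using that by (simp add: gbinomial_Vandermonde jacobi_coeff_def add_ac)
  qed
  have "jacobi_P N \<alpha> \<beta> (1 + 2 * Y) = (\<Sum>t=0..N. \<Sum>k=t..N. g t k)"
  proof -
    have *: "(1 + 2 * Y - 1) / 2 = Y" "(1 + 2 * Y + 1) / 2 = Y + 1"
      by (simp_all add: field_simps)
    show ?thesis
      unfolding jacobi_P_def * by (intro sum.cong) (simp_all add: inner)
  qed
  also have "\<dots> = (\<Sum>k=0..N. \<Sum>t=0..k. g t k)"
    unfolding sum.Sigma[OF finite_atLeastAtMost ballI[OF finite_atLeastAtMost]]
    by (rule sum.reindex_bij_witness[of _ "\<lambda>(k, t). (t, k)" "\<lambda>(t, k). (k, t)"]) auto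
  also have "\<dots> = poly (jacobi_poly N \<alpha> (\<alpha> + \<beta>)) Y"
    by (simp add: coeff jacobi_poly_def poly_sum poly_monom atMost_atLeast0)
  finally show ?thesis .
qed

section \<open>Positivity for nonnegative arguments\<close>

lemma gbinomial_pos:
  fixes z :: real
  assumes "z \<ge> real k"
  shows "z gchoose k > 0"
  unfolding gbinomial_prod_rev using assms by (intro divide_pos_pos prod_pos) auto

lemma jacobi_coeff_nonneg:
  assumes "\<alpha> \<ge> 0" "\<sigma> \<ge> 0"
  shows "jacobi_coeff N \<alpha> \<sigma> k \<ge> 0"
  using assms by (auto simp: jacobi_coeff_def intro!: mult_nonneg_nonneg less_imp_le[OF gbinomial_pos])

lemma poly_jacobi_pos:
  assumes "\<alpha> \<ge> 0" "\<sigma> \<ge> 0" "Y \<ge> 0"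
  shows "poly (jacobi_poly N \<alpha> \<sigma>) Y > 0"
proof -
  have "0 < jacobi_coeff N \<alpha> \<sigma> 0 * Y ^ 0"
    using assms by (auto simp: jacobi_coeff_def intro!: gbinomial_pos)
  then show ?thesis
    unfolding jacobi_poly_def poly_sum poly_monom
    by (intro sum_pos2[where i = 0]) (use assms in \<open>auto intro!: mult_nonneg_nonneg jacobi_coeff_nonneg\<close>)
qed

lemma poly_pderiv_jacobi_nonneg:
  assumes "\<alpha> \<ge> 0" "\<sigma> \<ge> 0" "Y \<ge> 0"
  shows "poly (pderiv (jacobi_poly N \<alpha> \<sigma>)) Y \<ge> 0"
  unfolding poly_altdef coeff_pderiv using assms
  by (auto intro!: sum_nonneg mult_nonneg_nonneg jacobi_coeff_nonneg)

section \<open>Differential equation and contiguous relation\<close>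

text \<open>The hypergeometric ratio of consecutive coefficients, with denominators cleared. It
  persists for \<open>k \<ge> N\<close>: the factor N - k vanishes at k = N, and the coefficients
  are cut off to 0 beyond N.\<close>

lemma jacobi_coeff_Suc:
  "real (Suc k) * (\<alpha> + real k + 1) * jacobi_coeff N \<alpha> \<sigma> (Suc k)
     = (real N - real k) * (real N + \<sigma> + real k + 1) * jacobi_coeff N \<alpha> \<sigma> k"
proof (cases "k < N")
  case True
  define j where "j = N - Suc k"
  have j: "N - k = Suc j" "N - Suc k = j" "real j = real N - real k - 1"
    using True by (auto simp: j_def of_nat_diff)
  have 1: "(\<alpha> + real k + 1) * ((real N + \<alpha>) gchoose j) = (real N - real k) * ((real N + \<alpha>) gchoose Suc j)"
    using gbinomial_mult_1[of "real N + \<alpha>" j] by (simp add: j(3) algebra_simps)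
  have 2: "real (Suc k) * ((real N + \<sigma> + real (Suc k)) gchoose Suc k)
      = (real N + \<sigma> + real k + 1) * ((real N + \<sigma> + real k) gchoose k)"
    using gbinomial_factors[of "real N + \<sigma> + real k" k] by (simp add: field_simps)
  have "real (Suc k) * (\<alpha> + real k + 1) * jacobi_coeff N \<alpha> \<sigma> (Suc k)
      = ((\<alpha> + real k + 1) * ((real N + \<alpha>) gchoose j))
        * (real (Suc k) * ((real N + \<sigma> + real (Suc k)) gchoose Suc k))"
    using True by (simp add: jacobi_coeff_def j mult_ac del: of_nat_Suc)
  also have "\<dots> = (real N - real k) * (real N + \<sigma> + real k + 1) * jacobi_coeff N \<alpha> \<sigma> k"
    unfolding 1 2 using True by (simp add: jacobi_coeff_def j mult_ac)
  finally show ?thesis .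
qed (auto simp: jacobi_coeff_def)

lemma jacobi_poly_ode:
  fixes N :: nat and \<alpha> \<sigma> :: real
  defines "p \<equiv> jacobi_poly N \<alpha> \<sigma>"
  shows "Y * (1 + Y) * poly (pderiv (pderiv p)) Y + (\<alpha> + 1 + (\<sigma> + 2) * Y) * poly (pderiv p) Y
     = real N * (real N + \<sigma> + 1) * poly p Y"
proof -
  have "[:0, 1, 1:] * pderiv (pderiv p) + [:\<alpha> + 1, \<sigma> + 2:] * pderiv p
      = smult (real N * (real N + \<sigma> + 1)) p"
  proof (rule poly_eqI)
    fix k
    have "coeff ([:0, 1, 1:] * pderiv (pderiv p) + [:\<alpha> + 1, \<sigma> + 2:] * pderiv p) k
        = real (Suc k) * (\<alpha> + real k + 1) * jacobi_coeff N \<alpha> \<sigma> (Suc k)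
          + real k * (real k + \<sigma> + 1) * jacobi_coeff N \<alpha> \<sigma> k"
      by (auto simp: p_def coeff_pderiv coeff_pCons algebra_simps split: nat.splits)
    \<comment> \<open>Uses (N - k)(N + \<sigma> + k + 1) + k(k + \<sigma> + 1) = N(N + \<sigma> +
      1).\<close>
    also have "\<dots> = coeff (smult (real N * (real N + \<sigma> + 1)) p) k"
      unfolding jacobi_coeff_Suc by (simp add: p_def algebra_simps)
    finally show "coeff ([:0, 1, 1:] * pderiv (pderiv p) + [:\<alpha> + 1, \<sigma> + 2:] * pderiv p) k
        = coeff (smult (real N * (real N + \<sigma> + 1)) p) k" .
  qed
  from arg_cong[OF this, of "\<lambda>q. poly q Y"] show ?thesis
    by (simp add: algebra_simps)
qed

section \<open>Contiguous relation between neighbouring degrees\<close>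

lemma jacobi_coeff_Suc_degree_0:
  "real (Suc M) * jacobi_coeff (Suc M) \<alpha> \<sigma> 0 = (real (Suc M) + \<alpha>) * jacobi_coeff M \<alpha> \<sigma> 0"
  using gbinomial_factors[of "real M + \<alpha>" M] by (simp add: jacobi_coeff_def field_simps)

text \<open>Degree and index rise together, so the lower index of the first binomial stays
  \<open>M - j\<close>, and absorption identities account for the shifted arguments.\<close>

lemma jacobi_coeff_Suc_degree_Suc:
  "real (Suc j) * (\<alpha> + real j + 1) * (real (Suc M) + \<sigma>) * jacobi_coeff (Suc M) \<alpha> \<sigma> (Suc j)
     = (real (Suc M) + \<alpha>) * (real M + \<sigma> + real j + 2) * (real M + \<sigma> + real j + 1)
        * jacobi_coeff M \<alpha> \<sigma> j"
proof (cases "j \<le> M")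
  case True
  define r where "r = M - j"
  have r: "real r = real M - real j"
    using True by (simp add: r_def of_nat_diff)
  have 1: "(\<alpha> + real j + 1) * ((real (Suc M) + \<alpha>) gchoose r)
      = (real (Suc M) + \<alpha>) * ((real M + \<alpha>) gchoose r)"
    using gbinomial_absorb_comp[of "real (Suc M) + \<alpha>" r] by (simp add: r algebra_simps)
  have 2: "real (Suc j) * ((real (Suc M) + \<sigma> + real (Suc j)) gchoose Suc j)
      = (real M + \<sigma> + real j + 2) * ((real M + \<sigma> + real j + 1) gchoose j)"
    using gbinomial_factors[of "real M + \<sigma> + real j + 1" j] by (simp add: field_simps)
  have 3: "(real (Suc M) + \<sigma>) * ((real M + \<sigma> + real j + 1) gchoose j)
      = (real M + \<sigma> + real j + 1) * ((real M + \<sigma> + real j) gchoose j)"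
    using gbinomial_absorb_comp[of "real M + \<sigma> + real j + 1" j] by (simp add: algebra_simps)
  have "real (Suc j) * (\<alpha> + real j + 1) * (real (Suc M) + \<sigma>) * jacobi_coeff (Suc M) \<alpha> \<sigma> (Suc j)
      = ((\<alpha> + real j + 1) * ((real (Suc M) + \<alpha>) gchoose r)) * (real (Suc M) + \<sigma>)
        * (real (Suc j) * ((real (Suc M) + \<sigma> + real (Suc j)) gchoose Suc j))"
    using True by (simp add: jacobi_coeff_def r_def mult_ac del: of_nat_Suc)
  also have "\<dots> = (real (Suc M) + \<alpha>) * ((real M + \<alpha>) gchoose r) * (real M + \<sigma> + real j + 2)
        * ((real (Suc M) + \<sigma>) * ((real M + \<sigma> + real j + 1) gchoose j))"
    unfolding 1 2 by (simp only: mult_ac)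
  also have "\<dots> = (real (Suc M) + \<alpha>) * (real M + \<sigma> + real j + 2) * (real M + \<sigma> + real j + 1)
        * jacobi_coeff M \<alpha> \<sigma> j"
    unfolding 3 using True by (simp add: jacobi_coeff_def r_def mult_ac del: of_nat_Suc)
  finally show ?thesis .
qed (auto simp: jacobi_coeff_def)

text \<open>Compare coefficients: at index \<open>Suc j\<close> both recurrences reduce everything
  to the one coefficient \<open>C\<close>, which leaves a polynomial identity.\<close>

lemma jacobi_poly_contiguous:
  fixes M :: nat and \<alpha> \<sigma> :: real
  assumes "\<alpha> \<ge> 0" "\<sigma> \<ge> 0"
  defines "B \<equiv> jacobi_poly M \<alpha> \<sigma>" and "n \<equiv> real (Suc M)"
  shows "n * (n + \<sigma>) * poly (jacobi_poly (Suc M) \<alpha> \<sigma>) Y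
     = (n + \<sigma>) * (n + \<alpha> + (2 * n + \<sigma>) * Y) * poly B Y
       + (2 * n + \<sigma>) * (Y * (1 + Y)) * poly (pderiv B) Y"
proof -
  let ?A = "jacobi_poly (Suc M) \<alpha> \<sigma>"
  have "smult (n * (n + \<sigma>)) ?A
      = smult (n + \<sigma>) ([:n + \<alpha>, 2 * n + \<sigma>:] * B) + smult (2 * n + \<sigma>) ([:0, 1, 1:] * pderiv B)"
    (is "_ = ?R")
  proof (rule poly_eqI)
    fix k
    show "coeff (smult (n * (n + \<sigma>)) ?A) k = coeff ?R k"
    proof (cases k)
      case 0
      have "n * jacobi_coeff (Suc M) \<alpha> \<sigma> 0 = (n + \<alpha>) * jacobi_coeff M \<alpha> \<sigma> 0"
        unfolding n_def by (rule jacobi_coeff_Suc_degree_0)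
      then show ?thesis
        by (simp add: 0 B_def mult_ac)
    next
      case (Suc j)
      define C where "C = jacobi_coeff M \<alpha> \<sigma> j"
      \<comment> \<open>Common denominator of the two recurrences; being positive, it can be
        cancelled at the end.\<close>
      define D where "D = real (Suc j) * (\<alpha> + real j + 1)"
      have "D > 0"
        using assms by (simp add: D_def)
      have R: "coeff ?R k = ((n + \<sigma>) * (n + \<alpha>) + (2 * n + \<sigma>) * real (Suc j)) * jacobi_coeff M \<alpha> \<sigma> (Suc j)
          + (2 * n + \<sigma>) * (n + \<sigma> + real j) * C"
        by (auto simp: Suc B_def C_def coeff_pderiv coeff_pCons algebra_simps split: nat.splits)
      have 1: "D * jacobi_coeff M \<alpha> \<sigma> (Suc j) = (n - 1 - real j) * (n + \<sigma> + real j) * C"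
        using jacobi_coeff_Suc[of j \<alpha> M \<sigma>] by (simp add: D_def C_def n_def add_ac)
      have 2: "D * (n + \<sigma>) * jacobi_coeff (Suc M) \<alpha> \<sigma> (Suc j)
          = (n + \<alpha>) * (n + \<sigma> + real j + 1) * (n + \<sigma> + real j) * C"
        using jacobi_coeff_Suc_degree_Suc[of j \<alpha> M \<sigma>] by (simp add: D_def C_def n_def add_ac)
      have "D * coeff (smult (n * (n + \<sigma>)) ?A) k
          = n * (D * (n + \<sigma>) * jacobi_coeff (Suc M) \<alpha> \<sigma> (Suc j))"
        by (simp add: Suc)
      also have "\<dots> = ((n + \<sigma>) * (n + \<alpha>) + (2 * n + \<sigma>) * real (Suc j)) * ((n - 1 - real j) * (n + \<sigma> + real j) * C)
          + (2 * n + \<sigma>) * (n + \<sigma> + real j) * C * D"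
        unfolding 2 by (simp add: D_def) algebra
      also have "\<dots> = D * coeff ?R k"
        unfolding R 1[symmetric] by algebra
      finally show ?thesis
        using \<open>D > 0\<close> by simp
    qed
  qed
  from arg_cong[OF this, of "\<lambda>q. poly q Y"] show ?thesis
    by (simp add: algebra_simps)
qed

section \<open>Comparison of the Riccati equations\<close>

text \<open>At the least point \<open>m\<close> with \<open>f m \<le> 0\<close> the value is 0, and
  a positive derivative there would make \<open>f\<close> negative just to the left of
  \<open>m\<close>.\<close>

lemma pos_by_first_zero:
  fixes f f' :: "real \<Rightarrow> real"
  assumes deriv: "\<And>x. x \<ge> 0 \<Longrightarrow> (f has_real_derivative f' x) (at x)"
    and "f 0 > 0" and cross: "\<And>x. x > 0 \<Longrightarrow> f x = 0 \<Longrightarrow> f' x > 0"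
    and "x \<ge> 0"
  shows "f x > 0"
proof (rule ccontr)
  assume "\<not> f x > 0"
  define Z where "Z = {z \<in> {0..x}. f z \<le> 0}"
  have cont: "continuous_on {0..x} f"
    using deriv by (intro continuous_at_imp_continuous_on) (metis DERIV_isCont atLeastAtMost_iff)
  have "Z = f -` {..0} \<inter> {0..x}"
    by (auto simp: Z_def)
  then have "closed Z"
    using cont by (simp add: continuous_on_closed_vimage)
  then have "compact ({0..x} \<inter> Z)"
    by (intro compact_Int_closed) simp_all
  moreover have "{0..x} \<inter> Z = Z" "Z \<noteq> {}"
    using \<open>\<not> f x > 0\<close> \<open>x \<ge> 0\<close> by (auto simp: Z_def)
  ultimately obtain m where "m \<in> Z" and least: "\<And>z. z \<in> Z \<Longrightarrow> m \<le> z"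
    using compact_attains_inf[of Z] by metis
  have m: "0 \<le> m" "m \<le> x" "f m \<le> 0"
    using \<open>m \<in> Z\<close> by (simp_all add: Z_def)
  have below: "f z > 0" if "0 \<le> z" "z < m" for z
  proof (rule ccontr)
    assume "\<not> f z > 0"
    then have "z \<in> Z"
      using that m by (simp add: Z_def)
    then show False
      using least that by force
  qed
  have "m > 0"
    using m \<open>f 0 > 0\<close> by (cases "m = 0") auto
  have "f m = 0"
  proof (rule ccontr)
    assume "f m \<noteq> 0"
    with m have "f m < 0" by simp
    have "\<exists>z\<ge>0. z \<le> m \<and> f z = 0"
      by (rule IVT2') (use m \<open>f 0 > 0\<close> continuous_on_subset[OF cont] in auto)
    then show False
      using below \<open>f m \<noteq> 0\<close> by force
  qed
  then obtain d where d: "d > 0" "\<And>h. h > 0 \<Longrightarrow> h < d \<Longrightarrow> f (m - h) < f m"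
    using DERIV_pos_inc_left[OF deriv[OF m(1)]] cross \<open>m > 0\<close> by blast
  \<comment> \<open>The minimum with \<open>m\<close> keeps \<open>m - h\<close> in the domain,
    where \<open>below\<close> applies.\<close>
  define h where "h = min (d / 2) m"
  have "h > 0" "h < d" "h \<le> m"
    using d(1) \<open>m > 0\<close> by (auto simp: h_def)
  then show False
    using d(2)[of h] below[of "m - h"] \<open>f m = 0\<close> by simp
qed

text \<open>The functions \<open>y\<^sub>n\<close> and \<open>G (\<cdot>, y\<^sub>n)\<close> of the introduction, with \<open>n = M + 1\<close>.\<close>

definition log_deriv :: "real \<Rightarrow> real \<Rightarrow> nat \<Rightarrow> real \<Rightarrow> real" where
  "log_deriv a c M Y = (let n = real (Suc M); B = jacobi_poly M (a * n) (c * n)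
     in poly (pderiv B) Y / (n * poly B Y))"

definition riccati :: "real \<Rightarrow> real \<Rightarrow> real \<Rightarrow> real \<Rightarrow> real" where
  "riccati a c Y y = 1 + c - Y * (1 + Y) * y\<^sup>2 - (a + c * Y) * y"

lemma log_deriv_nonneg:
  assumes "a \<ge> 0" "c \<ge> 0" "Y \<ge> 0"
  shows "log_deriv a c M Y \<ge> 0"
  unfolding log_deriv_def Let_def using assms
  by (intro divide_nonneg_nonneg mult_nonneg_nonneg poly_pderiv_jacobi_nonneg
      less_imp_le[OF poly_jacobi_pos]) auto

text \<open>Substitute \<open>p1 = n * p * y\<close> and
  \<open>p2 = n * p * (y' + n * y\<^sup>2)\<close> into Jacobi's equation and divide by
  \<open>n * p\<close>. Parameters proportional to \<open>n\<close> make its right side n(n - 1)(1 +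
  c)p.\<close>

lemma log_deriv_ode:
  assumes "a \<ge> 0" "c \<ge> 0"
  obtains y' where
    "\<And>Y. Y \<ge> 0 \<Longrightarrow> (log_deriv a c M has_real_derivative y' Y) (at Y)"
    "\<And>Y. Y \<ge> 0 \<Longrightarrow> Y * (1 + Y) * y' Y + (1 + 2 * Y) * log_deriv a c M Y + (1 + c)
        = real (Suc M) * riccati a c Y (log_deriv a c M Y)"
proof -
  define n where "n = real (Suc M)"
  define B where "B = jacobi_poly M (a * n) (c * n)"
  define y where "y = log_deriv a c M"
  define y' where "y' Y = poly (pderiv (pderiv B)) Y / (n * poly B Y) - n * (y Y)\<^sup>2" for Y
  have "n > 0" by (simp add: n_def)
  have y: "y Y = poly (pderiv B) Y / (n * poly B Y)" for Y
    by (simp add: y_def log_deriv_def Let_def B_def n_def)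
  have B: "poly B Y > 0" if "Y \<ge> 0" for Y
    unfolding B_def by (rule poly_jacobi_pos) (use assms \<open>n > 0\<close> that in auto)
  show ?thesis
  proof (rule that[of y'])
    fix Y :: real assume "Y \<ge> 0"
    have "((\<lambda>Y. poly (pderiv B) Y / (n * poly B Y)) has_real_derivative y' Y) (at Y)"
      unfolding y'_def y using B[OF \<open>Y \<ge> 0\<close>] \<open>n > 0\<close>
      by (auto intro!: derivative_eq_intros poly_DERIV simp: field_simps power2_eq_square)
    then show "(log_deriv a c M has_real_derivative y' Y) (at Y)"
      unfolding y[symmetric] y_def .
  next
    fix Y :: real assume "Y \<ge> 0"
    define p p1 p2 where "p = poly B Y" and "p1 = poly (pderiv B) Y" and "p2 = poly (pderiv (pderiv B)) Y"
    have "p > 0" using B \<open>Y \<ge> 0\<close> by (simp add: p_def)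
    have "p1 = n * p * y Y" "p2 = n * p * (y' Y + n * (y Y)\<^sup>2)"
      using \<open>p > 0\<close> \<open>n > 0\<close> by (simp_all add: y'_def y p_def p1_def p2_def)
    moreover have "Y * (1 + Y) * p2 + (a * n + 1 + (c * n + 2) * Y) * p1
        = (n - 1) * (n + c * n) * p"
      using jacobi_poly_ode[of Y M "a * n" "c * n"]
      by (simp add: p_def p1_def p2_def B_def n_def)
    ultimately have "n * p * (Y * (1 + Y) * y' Y + (1 + 2 * Y) * y Y + (1 + c))
        = n * p * (n * riccati a c Y (y Y))"
      unfolding riccati_def by algebra
    then show "Y * (1 + Y) * y' Y + (1 + 2 * Y) * log_deriv a c M Y + (1 + c)
        = real (Suc M) * riccati a c Y (log_deriv a c M Y)"
      using \<open>n > 0\<close> \<open>p > 0\<close> by (simp add: y_def n_def)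
  qed
qed

text \<open>At a zero of G the Riccati equation forces \<open>y\<close> to decrease; as G decreases
  in y \<ge> 0, this pushes G up and outweighs its explicit decrease in \<open>Y\<close>.\<close>

lemma riccati_log_deriv_pos:
  assumes "a \<ge> 0" "c \<ge> 0" "Y \<ge> 0"
  shows "riccati a c Y (log_deriv a c M Y) > 0"
proof -
  define y where "y = log_deriv a c M"
  obtain y' where y': "\<And>Y. Y \<ge> 0 \<Longrightarrow> (y has_real_derivative y' Y) (at Y)"
    and ode: "\<And>Y. Y \<ge> 0 \<Longrightarrow> Y * (1 + Y) * y' Y + (1 + 2 * Y) * y Y + (1 + c)
        = real (Suc M) * riccati a c Y (y Y)"
    using log_deriv_ode[OF assms(1,2), of M] unfolding y_def by metis
  have y_nonneg: "y Y \<ge> 0" if "Y \<ge> 0" for Y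
    using log_deriv_nonneg assms that by (simp add: y_def)
  define h' where "h' Y = - (1 + 2 * Y) * (y Y)\<^sup>2 - c * y Y
      - (2 * (Y * (1 + Y)) * y Y + (a + c * Y)) * y' Y" for Y
  have "riccati a c Y (y Y) > 0"
  proof (rule pos_by_first_zero[where f = "\<lambda>Y. riccati a c Y (y Y)" and f' = h'])
    show "((\<lambda>Y. riccati a c Y (y Y)) has_real_derivative h' Y) (at Y)" if "Y \<ge> 0" for Y
      unfolding riccati_def h'_def
      by (auto intro!: derivative_eq_intros y'[OF that] simp: algebra_simps power2_eq_square)
    \<comment> \<open>At 0 the derivative term drops out, leaving y(0) + 1 + c on the left of the
      equation.\<close>
    have "real (Suc M) * riccati a c 0 (y 0) > 0"
      using ode[of 0] y_nonneg[of 0] assms by simp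
    then show "riccati a c 0 (y 0) > 0"
      by (simp add: zero_less_mult_iff)
    show "h' Y > 0" if "Y > 0" and zero: "riccati a c Y (y Y) = 0" for Y
    proof -
      define E where "E = (1 + 2 * Y) * y Y + (1 + c)"
      have "y Y \<noteq> 0"
        using zero assms by (auto simp: riccati_def)
      then have "y Y > 0"
        using y_nonneg[of Y] \<open>Y > 0\<close> by simp
      then have "E > 0"
        using assms \<open>Y > 0\<close> by (simp add: E_def add_pos_pos)
      have W: "Y * (1 + Y) * y' Y = - E"
        using ode[of Y] zero \<open>Y > 0\<close> by (simp add: E_def)
      \<comment> \<open>Multiplying by Y(1 + Y) allows \<open>W\<close> to eliminate
        \<open>y'\<close>; the resulting term 2yE then absorbs both negative terms.\<close>
      have "Y * (1 + Y) * h' Y = Y * (1 + Y) * (- (1 + 2 * Y) * (y Y)\<^sup>2 - c * y Y)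
          - (2 * (Y * (1 + Y)) * y Y + (a + c * Y)) * (Y * (1 + Y) * y' Y)"
        unfolding h'_def by algebra
      also have "\<dots> = Y * (1 + Y) * ((1 + 2 * Y) * (y Y)\<^sup>2 + (2 + c) * y Y) + (a + c * Y) * E"
        unfolding W unfolding E_def by algebra
      also have "\<dots> > 0"
        using \<open>Y > 0\<close> \<open>y Y > 0\<close> \<open>E > 0\<close> assms
        by (intro add_pos_nonneg mult_pos_pos mult_nonneg_nonneg) auto
      finally show ?thesis
        by (rule zero_less_mult_pos) (use \<open>Y > 0\<close> in simp)
    qed
  qed (use assms in auto)
  then show ?thesis by (simp add: y_def)
qed

lemma log_deriv_strict_mono:
  assumes "a \<ge> 0" "c \<ge> 0" "Y \<ge> 0"
  shows "log_deriv a c M Y < log_deriv a c (Suc M) Y"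
proof -
  define y where "y = log_deriv a c M"
  define z where "z = log_deriv a c (Suc M)"
  obtain y' where y': "\<And>Y. Y \<ge> 0 \<Longrightarrow> (y has_real_derivative y' Y) (at Y)"
    and y_ode: "\<And>Y. Y \<ge> 0 \<Longrightarrow> Y * (1 + Y) * y' Y + (1 + 2 * Y) * y Y + (1 + c)
        = real (Suc M) * riccati a c Y (y Y)"
    using log_deriv_ode[OF assms(1,2), of M] unfolding y_def by metis
  obtain z' where z': "\<And>Y. Y \<ge> 0 \<Longrightarrow> (z has_real_derivative z' Y) (at Y)"
    and z_ode: "\<And>Y. Y \<ge> 0 \<Longrightarrow> Y * (1 + Y) * z' Y + (1 + 2 * Y) * z Y + (1 + c)
        = real (Suc (Suc M)) * riccati a c Y (z Y)"
    using log_deriv_ode[OF assms(1,2), of "Suc M"] unfolding z_def by metis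
  have "z Y - y Y > 0"
  proof (rule pos_by_first_zero[where f = "\<lambda>Y. z Y - y Y" and f' = "\<lambda>Y. z' Y - y' Y"])
    show "((\<lambda>Y. z Y - y Y) has_real_derivative z' Y - y' Y) (at Y)" if "Y \<ge> 0" for Y
      using DERIV_diff[OF z'[OF that] y'[OF that]] .
    show "z 0 - y 0 > 0"
    proof -
      \<comment> \<open>At 0 the equations are linear in the unknown values: y(0) = (1 + c)M / (1 +
        a(M + 1)), and likewise for \<open>z\<close> with M + 1 in place of M.\<close>
      have "y 0 + (1 + c) = (real M + 1) * (1 + c - a * y 0)"
        "z 0 + (1 + c) = (real M + 2) * (1 + c - a * z 0)"
        using y_ode[of 0] z_ode[of 0] by (simp_all add: riccati_def algebra_simps)
      then have "(1 + a * (real M + 1)) * (1 + a * (real M + 2)) * (z 0 - y 0) = (1 + c) * (1 + a)"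
        by algebra
      also have "\<dots> > 0"
        using assms by (intro mult_pos_pos) auto
      finally show ?thesis
        by (rule zero_less_mult_pos) (use assms in \<open>auto intro!: mult_pos_pos add_pos_nonneg\<close>)
    qed
    show "z' Y - y' Y > 0" if "Y > 0" and zero: "z Y - y Y = 0" for Y
    proof -
      \<comment> \<open>Where y = z the two equations differ only in the factors M + 2 and M + 1, so
        subtracting them leaves a single G.\<close>
      have "Y * (1 + Y) * (z' Y - y' Y) = riccati a c Y (y Y)"
        using y_ode[of Y] z_ode[of Y] zero \<open>Y > 0\<close> by (simp add: algebra_simps)
      also have "\<dots> > 0"
        using riccati_log_deriv_pos[OF assms(1,2), of Y M] \<open>Y > 0\<close> by (simp add: y_def)
      finally show ?thesis
        by (rule zero_less_mult_pos) (use \<open>Y > 0\<close> in simp)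
    qed
  qed (use assms in auto)
  then show ?thesis by (simp add: y_def z_def)
qed

section \<open>The Turan-type inequality\<close>

lemma jacobi_P_pos:
  assumes "\<alpha> \<ge> 0" "\<beta> \<ge> 0" "x \<ge> 1"
  shows "jacobi_P N \<alpha> \<beta> x > 0"
proof -
  have "jacobi_P N \<alpha> \<beta> x = poly (jacobi_poly N \<alpha> (\<alpha> + \<beta>)) ((x - 1) / 2)"
    using jacobi_P_eq_poly[of N \<alpha> \<beta> "(x - 1) / 2"] by (simp add: field_simps)
  then show ?thesis
    using assms by (simp add: poly_jacobi_pos)
qed

text \<open>With parameters proportional to \<open>n\<close> every term of the contiguous relation
  carries \<open>n\<^sup>2\<close>. The ratio of the two degrees thus depends on \<open>n\<close>
  only through \<open>log_deriv\<close>.\<close>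

lemma jacobi_P_Suc_degree:
  fixes a b Y :: real and M :: nat
  assumes "a \<ge> 0" "b \<ge> 0" "Y \<ge> 0"
  defines "n \<equiv> real (Suc M)" and "c \<equiv> a + b"
  shows "jacobi_P (Suc M) (a * n) (b * n) (1 + 2 * Y)
     = (1 + a + (2 + c) * Y + (2 + c) / (1 + c) * (Y * (1 + Y)) * log_deriv a c M Y)
        * jacobi_P M (a * n) (b * n) (1 + 2 * Y)"
proof -
  define B where "B = jacobi_poly M (a * n) (c * n)"
  define A where "A = jacobi_poly (Suc M) (a * n) (c * n)"
  have "n > 0" "1 + c > 0" using assms by (auto simp: n_def c_def)
  have J: "jacobi_P N (a * n) (b * n) (1 + 2 * Y) = poly (jacobi_poly N (a * n) (c * n)) Y" for N
    by (simp add: jacobi_P_eq_poly c_def distrib_right)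
  have B: "poly B Y > 0"
    unfolding B_def by (rule poly_jacobi_pos) (use assms \<open>n > 0\<close> in auto)
  have D: "poly (pderiv B) Y = n * log_deriv a c M Y * poly B Y"
    using B \<open>n > 0\<close> by (simp add: log_deriv_def Let_def B_def n_def)
  have "n * (n + c * n) * poly A Y = (n + c * n) * (n + a * n + (2 * n + c * n) * Y) * poly B Y
       + (2 * n + c * n) * (Y * (1 + Y)) * poly (pderiv B) Y"
    unfolding A_def B_def n_def by (rule jacobi_poly_contiguous) (use assms in auto)
  then have "n\<^sup>2 * ((1 + c) * poly A Y)
      = n\<^sup>2 * (((1 + c) * (1 + a + (2 + c) * Y) + (2 + c) * (Y * (1 + Y)) * log_deriv a c M Y) * poly B Y)"
    unfolding D by algebra
  then have "(1 + c) * poly A Y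
      = ((1 + c) * (1 + a + (2 + c) * Y) + (2 + c) * (Y * (1 + Y)) * log_deriv a c M Y) * poly B Y"
    using \<open>n > 0\<close> by simp
  then have "poly A Y
      = (1 + a + (2 + c) * Y + (2 + c) / (1 + c) * (Y * (1 + Y)) * log_deriv a c M Y) * poly B Y"
    using \<open>1 + c > 0\<close> by (simp add: field_simps)
  then show ?thesis
    unfolding J A_def B_def .
qed

theorem theorem1:
  fixes a b :: real and n :: nat
  assumes "a \<ge> 0" and "b \<ge> 0" and "n \<ge> 1"
  shows "\<forall>x::real. x \<ge> 1 \<longrightarrow> Delta a b n x \<le> 0 \<and> (Delta a b n x = 0 \<longleftrightarrow> x = 1)"
proof (intro allI impI)
  fix x :: real assume "x \<ge> 1"
  define Y where "Y = (x - 1) / 2"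
  have x: "x = 1 + 2 * Y" and "Y \<ge> 0" using \<open>x \<ge> 1\<close> by (simp_all add: Y_def field_simps)
  obtain M where n: "n = Suc M" using \<open>n \<ge> 1\<close> by (cases n) auto
  define c where "c = a + b"
  define y where "y N = log_deriv a c N Y" for N
  define B where "B N = jacobi_P N (a * real (Suc N)) (b * real (Suc N)) x" for N
  have A: "jacobi_P (Suc N) (a * real (Suc N)) (b * real (Suc N)) x
      = (1 + a + (2 + c) * Y + (2 + c) / (1 + c) * (Y * (1 + Y)) * y N) * B N" for N
    unfolding B_def y_def c_def x by (rule jacobi_P_Suc_degree) (use assms \<open>Y \<ge> 0\<close> in auto)
  have "Delta a b n x
      = jacobi_P (Suc M) (a * real (Suc M)) (b * real (Suc M)) x * B (Suc M)
        - B M * jacobi_P (Suc (Suc M)) (a * real (Suc (Suc M))) (b * real (Suc (Suc M))) x"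
    by (simp add: Delta_def n B_def)
  \<comment> \<open>The part 1 + a + (2 + c)Y is common to both ratios and cancels.\<close>
  also have "\<dots> = (2 + c) / (1 + c) * (Y * (1 + Y)) * (y M - y (Suc M)) * (B M * B (Suc M))"
    unfolding A by algebra
  \<comment> \<open>The factor \<open>Y\<close> is split off because it alone can vanish, exactly at
    x = 1.\<close>
  finally have Delta: "Delta a b n x
      = - ((2 + c) / (1 + c) * (B M * B (Suc M)) * (y (Suc M) - y M) * (1 + Y)) * Y"
    by algebra
  have "y M < y (Suc M)"
    unfolding y_def by (rule log_deriv_strict_mono) (use assms \<open>Y \<ge> 0\<close> in \<open>auto simp: c_def\<close>)
  moreover have "B N > 0" for N
    unfolding B_def by (rule jacobi_P_pos) (use assms \<open>x \<ge> 1\<close> in auto)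
  moreover define K where "K = (2 + c) / (1 + c) * (B M * B (Suc M)) * (y (Suc M) - y M) * (1 + Y)"
  ultimately have "K > 0"
    using assms \<open>Y \<ge> 0\<close> unfolding K_def by (intro mult_pos_pos divide_pos_pos) (auto simp: c_def)
  then show "Delta a b n x \<le> 0 \<and> (Delta a b n x = 0 \<longleftrightarrow> x = 1)"
    unfolding Delta K_def[symmetric] using \<open>Y \<ge> 0\<close> x by auto
qed

end
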